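(* Let $n\geq 2$ and let $M^n=P^{-1}(0)$ be a regular algebraic hypersurface in $\mathbb R^{n+1}$ defined by a polynomial $P:\mathbb R^{n+1}\to\mathbb R$ of degree $m$. If $M^n$ has non-zero constant mean curvature, then $m$ is even.
   Context: An algebraic hypersurface in $\mathbb R^{n+1}$ is the zero set $M=P^{-1}(0)$ of a (real) polynomial function $P:\mathbb R^{n+1}\to\mathbb R$. It is called regular if the gradient $\nabla P$ has no zeros on $M$; then $M$ is a properly embedded smooth hypersurface (not assumed connected). $M$ is oriented by the global unit normal vector field $N=\nabla P/|\nabla P|$. The shape operator of $M$ at $p$ is $A v=-dN_p(v)$, $v\in T_pM$, and the mean curvature is $H=\frac1n\operatorname{trace}A$. "Non-zero constant mean curvature" means that there is a real constant $c\neq 0$ such that $H(p)=c$ for every $p\in M$ (the same $c$ on all connected components, with respect to $N$). *)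

theory Defs
  imports "HOL-Analysis.Analysis" "HOL-Library.Poly_Mapping"
begin

section \<open>Real polynomials in several variables\<close>

text \<open>
  A polynomial is a finitely supported map from exponent vectors to coefficients, the variables
  being indexed by the same finite type as the coordinates of the ambient Euclidean space.
  As the reals are infinite, a polynomial function determines its polynomial, so its degree
  is well defined.
\<close>

type_synonym 'd real_mpoly = "('d \<Rightarrow>\<^sub>0 nat) \<Rightarrow>\<^sub>0 real"

definition mpoly_fun :: "'d::finite real_mpoly \<Rightarrow> real ^ 'd \<Rightarrow> real" where
  "mpoly_fun P x =
     (\<Sum>\<alpha>\<in>Poly_Mapping.keys P. Poly_Mapping.lookup P \<alpha> * (\<Prod>i\<in>UNIV. (x $ i) ^ Poly_Mapping.lookup \<alpha> i))"

text \<open>The zero polynomial gets degree 0, as in the univariate library.\<close>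

definition total_degree :: "'d::finite real_mpoly \<Rightarrow> nat" where
  "total_degree P =
     Max (insert 0 ((\<lambda>\<alpha>. \<Sum>i\<in>UNIV. Poly_Mapping.lookup \<alpha> i) ` Poly_Mapping.keys P))"

section \<open>Trace of an endomorphism of a subspace\<close>

text \<open>
  The sum of the diagonal entries of the matrix of \<open>A\<close> in some basis of \<open>V\<close>; by
  \<open>trace_on_eq\<close> below the choice of the basis is immaterial if \<open>A\<close> maps \<open>V\<close> to itself.
\<close>

definition trace_on :: "'a::euclidean_space set \<Rightarrow> ('a \<Rightarrow> 'a) \<Rightarrow> real" where
  "trace_on V A =
     (let B = (SOME B. independent B \<and> span B = V) in \<Sum>b\<in>B. representation B (A b) b)"

lemma trace_basis_change:
  fixes A :: "'a::euclidean_space \<Rightarrow> 'a"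
  assumes A: "linear A" and B: "independent B" and C: "independent C"
    and BC: "span B = span C" and maps: "A ` span C \<subseteq> span C"
  shows "(\<Sum>b\<in>B. representation B (A b) b) = (\<Sum>c\<in>C. representation C (A c) c)"
proof -
  have fin: "finite B" "finite C"
    using B C by (auto intro: independent_imp_finite)
  have spanA: "A v \<in> span B" "A v \<in> span C" if "v \<in> span C" for v
    using maps that BC by auto
  have expand: "representation E (f u) e = (\<Sum>c\<in>C. representation C u c * representation E (f c) e)"
    if E: "independent E" and f: "linear f" and u: "u \<in> span C"
      and fE: "\<And>c. c \<in> C \<Longrightarrow> f c \<in> span E" for E e u and f :: "'a \<Rightarrow> 'a"
  proof -
    have "f u = f (\<Sum>c\<in>C. representation C u c *\<^sub>R c)"
      using sum_representation_eq[OF C u fin(2) order_refl] by simp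
    also have "\<dots> = (\<Sum>c\<in>C. representation C u c *\<^sub>R f c)"
      using f by (simp add: linear_sum linear_scale)
    finally have fu: "f u = (\<Sum>c\<in>C. representation C u c *\<^sub>R f c)" .
    show ?thesis
      unfolding fu using E fE
      by (subst representation_sum) (auto simp: representation_scale intro: span_scale)
  qed
  have Bspan: "b \<in> span C" if "b \<in> B" for b
    using that BC span_base by blast
  have Cspan: "c \<in> span B" "c \<in> span C" if "c \<in> C" for c
    using that BC span_base by blast+
  have expandB: "representation C u e = (\<Sum>b\<in>B. representation B u b * representation C b e)"
    if u: "u \<in> span C" for u e
  proof -
    have uB: "u \<in> span B" using u BC by simp
    have "representation C u e = representation C (\<Sum>b\<in>B. representation B u b *\<^sub>R b) e"
      using sum_representation_eq[OF B uB fin(1) order_refl] by simp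
    then show ?thesis
      using C Bspan by (subst (asm) representation_sum)
        (auto simp: representation_scale intro: span_scale)
  qed
  have "(\<Sum>b\<in>B. representation B (A b) b)
      = (\<Sum>b\<in>B. \<Sum>c\<in>C. representation C b c * representation B (A c) b)"
    by (intro sum.cong refl expand B A) (auto intro: Bspan Cspan spanA)
  also have "\<dots> = (\<Sum>c\<in>C. \<Sum>b\<in>B. representation B (A c) b * representation C b c)"
    by (subst sum.swap) (simp add: mult.commute)
  also have "\<dots> = (\<Sum>c\<in>C. representation C (A c) c)"
    by (intro sum.cong refl expandB[symmetric] spanA Cspan)
  finally show ?thesis .
qed

lemma trace_on_eq:
  fixes A :: "'a::euclidean_space \<Rightarrow> 'a"
  assumes "linear A" "independent C" "span C = V" "A ` V \<subseteq> V"
  shows "trace_on V A = (\<Sum>c\<in>C. representation C (A c) c)"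
proof -
  define B where "B = (SOME B. independent B \<and> span B = V)"
  have "independent B \<and> span B = V"
    unfolding B_def by (rule someI[of _ C]) (use assms in auto)
  then have "(\<Sum>b\<in>B. representation B (A b) b) = (\<Sum>c\<in>C. representation C (A c) c)"
    using assms by (intro trace_basis_change) auto
  then show ?thesis
    by (simp add: trace_on_def B_def)
qed

section \<open>Level hypersurfaces\<close>

definition gradient :: "('a::real_inner \<Rightarrow> real) \<Rightarrow> 'a \<Rightarrow> 'a" where
  "gradient f x = (THE D. GDERIV f x :> D)"

definition zero_set :: "('a \<Rightarrow> real) \<Rightarrow> 'a set" where
  "zero_set f = {x. f x = 0}"

definition regular_hypersurface :: "('a::real_inner \<Rightarrow> real) \<Rightarrow> bool" where
  "regular_hypersurface f \<longleftrightarrow> (\<forall>p\<in>zero_set f. gradient f p \<noteq> 0)"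

definition unit_normal :: "('a::real_inner \<Rightarrow> real) \<Rightarrow> 'a \<Rightarrow> 'a" where
  "unit_normal f x = gradient f x /\<^sub>R norm (gradient f x)"

definition tangent_space :: "('a::real_inner \<Rightarrow> real) \<Rightarrow> 'a \<Rightarrow> 'a set" where
  "tangent_space f p = {v. gradient f p \<bullet> v = 0}"

text \<open>
  The formula for the unit normal makes sense on a neighbourhood of the hypersurface, and the
  differential at \<open>p\<close> of its restriction to the hypersurface is the restriction to the tangent
  space of its differential in the ambient space. The latter is used here; only its values on
  \<^term>\<open>tangent_space f p\<close> enter below.
\<close>

definition shape_operator :: "('a::real_inner \<Rightarrow> real) \<Rightarrow> 'a \<Rightarrow> 'a \<Rightarrow> 'a" where
  "shape_operator f p v = - frechet_derivative (unit_normal f) (at p) v"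

text \<open>The hypersurface has dimension \<open>DIM('a) - 1\<close>.\<close>

definition mean_curvature :: "('a::euclidean_space \<Rightarrow> real) \<Rightarrow> 'a \<Rightarrow> real" where
  "mean_curvature f p =
     1 / real (DIM('a) - 1) * trace_on (tangent_space f p) (shape_operator f p)"

definition nonzero_constant_mean_curvature :: "('a::euclidean_space \<Rightarrow> real) \<Rightarrow> bool" where
  "nonzero_constant_mean_curvature f \<longleftrightarrow>
     (\<exists>c. c \<noteq> 0 \<and> (\<forall>p\<in>zero_set f. mean_curvature f p = c))"

end

theory Submission
  imports Defs
begin

text \<open>
  If the degree is odd, the leading form takes both signs, so each of the regions \<open>P < 0\<close> and
  \<open>P > 0\<close> contains balls of arbitrarily large radius \<open>R\<close>. Enlarge such a ball in \<open>P < 0\<close> until it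
  touches the hypersurface: comparing with the sphere at the contact point gives \<open>H \<ge> - 1 / R\<close>.
  A ball in \<open>P > 0\<close> gives \<open>H \<le> 1 / R\<close> in the same way, so a constant \<open>H\<close> must vanish.
\<close>

section \<open>Gradients and the mean curvature of a level set\<close>

lemma gradient_eqI:
  assumes "GDERIV f x :> D"
  shows "gradient f x = D"
proof -
  have "E = D" if "GDERIV f x :> E" for E
  proof -
    have "(\<lambda>h. h \<bullet> E) = (\<lambda>h. h \<bullet> D)"
      using that assms unfolding gderiv_def by (rule has_derivative_unique)
    then have "(E - D) \<bullet> (E - D) = 0"
      by (metis inner_diff_right right_minus_eq)
    then show ?thesis by simp
  qed
  with assms show ?thesis
    unfolding gradient_def by blast
qed

text \<open>Because \<open>G\<close> is again polynomial, it is differentiable everywhere; its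
  derivative is the Hessian that enters the curvature formula.\<close>

lemma real_polynomial_function_gradient:
  fixes f :: "'a::euclidean_space \<Rightarrow> real"
  assumes "real_polynomial_function f"
  obtains G where "polynomial_function G" "\<And>x. GDERIV f x :> G x"
proof -
  have "\<exists>G. polynomial_function G \<and> (\<forall>x. GDERIV f x :> G x)"
    using assms
  proof (induction f rule: real_polynomial_function.induct)
    case (linear f)
    \<comment> \<open>\<open>adjoint f 1\<close> is the Riesz vector of the functional
      \<open>f\<close>.\<close>
    have "(\<lambda>h. h \<bullet> adjoint f 1) = f"
      using adjoint_works[OF bounded_linear.linear[OF linear], of _ 1] by (simp add: fun_eq_iff)
    then have "GDERIV f x :> adjoint f 1" for x
      using bounded_linear_imp_has_derivative[OF linear] by (simp add: gderiv_def)
    then show ?case by blast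
  next
    case (const c)
    show ?case by (intro exI[of _ "\<lambda>x. 0"] conjI allI GDERIV_const polynomial_function_const)
  next
    case (add f g)
    then obtain F G where "polynomial_function F" "polynomial_function G"
      and "\<forall>x. GDERIV f x :> F x" "\<forall>x. GDERIV g x :> G x" by blast
    then show ?case
      by (intro exI[of _ "\<lambda>x. F x + G x"] conjI allI GDERIV_add polynomial_function_add) auto
  next
    case (mult f g)
    then obtain F G where "polynomial_function F" "polynomial_function G"
      and "\<forall>x. GDERIV f x :> F x" "\<forall>x. GDERIV g x :> G x" by blast
    with mult.hyps show ?case
      by (intro exI[of _ "\<lambda>x. f x *\<^sub>R G x + g x *\<^sub>R F x"] conjI allI GDERIV_mult
          polynomial_function_add polynomial_function_mult) (auto simp: real_polynomial_function_eq)
  qed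
  with that show thesis by blast
qed

text \<open>Differentiating \<open>G / |G|\<close> along \<open>v\<close> gives
  \<open>H v / |G p|\<close> up to a multiple of \<open>G p\<close>, which pairs to zero with
  tangent vectors. In an orthonormal basis the diagonal entries of the shape operator are inner
  products, so the trace is a Hessian trace over the tangent space.\<close>

lemma mean_curvature_orthonormal_basis:
  fixes f :: "'a::euclidean_space \<Rightarrow> real"
  assumes G: "\<And>x. GDERIV f x :> G x" and H: "(G has_derivative H) (at p)" and nz: "G p \<noteq> 0"
    and B: "pairwise orthogonal B" "\<And>b. b \<in> B \<Longrightarrow> norm b = 1" "span B = {v. G p \<bullet> v = 0}"
  shows "mean_curvature f p = - (\<Sum>b\<in>B. b \<bullet> H b) / (real (DIM('a) - 1) * norm (G p))"
proof -
  have grad: "gradient f = G"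
    using gradient_eqI[OF G] by (simp add: fun_eq_iff)
  have indep: "independent B"
    using B(1,2) by (intro pairwise_orthogonal_independent) force+
  have fin: "finite B"
    using indep independent_imp_finite by blast
  define N' where "N' v = inverse (norm (G p)) *\<^sub>R H v
    - (inverse (norm (G p)) * inverse (norm (G p)) * (H v \<bullet> sgn (G p))) *\<^sub>R G p" for v
  have "((\<lambda>x. inverse (norm (G x)) *\<^sub>R G x) has_derivative N') (at p)"
    unfolding N'_def using nz
    by (auto intro!: derivative_eq_intros H has_derivative_compose[OF H has_derivative_norm]
        simp: fun_eq_iff)
  then have D: "(unit_normal f has_derivative N') (at p)"
    by (simp add: unit_normal_def[abs_def] grad)
  have shape: "shape_operator f p = (\<lambda>v. - N' v)"
    using frechet_derivative_at[OF D] by (simp add: shape_operator_def fun_eq_iff)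
  have lin: "linear (\<lambda>v. - N' v)"
    using has_derivative_linear[OF D] by (simp add: linear_compose_neg)
  \<comment> \<open>The derivative of a unit field is orthogonal to the field; hence the shape
    operator preserves the tangent space, as \<open>trace_on_eq\<close> requires.\<close>
  have "G p \<bullet> N' v = 0" for v
    using nz by (simp add: N'_def inner_diff_right sgn_div_norm inner_commute field_simps
        flip: power2_norm_eq_inner power2_eq_square)
  then have tang: "- N' v \<in> span B" for v
    using B(3) by simp
  have "trace_on (tangent_space f p) (shape_operator f p) = (\<Sum>b\<in>B. representation B (- N' b) b)"
    unfolding shape using indep lin tang B(3)
    by (intro trace_on_eq) (auto simp: tangent_space_def grad)
  also have "\<dots> = (\<Sum>b\<in>B. b \<bullet> - N' b)"
  proof (intro sum.cong refl)
    fix b assume b: "b \<in> B"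
    let ?w = "- N' b"
    have "b \<bullet> ?w = b \<bullet> (\<Sum>e\<in>B. representation B ?w e *\<^sub>R e)"
      using sum_representation_eq[OF indep tang fin order_refl] by simp
    also have "\<dots> = (\<Sum>e\<in>B. if e = b then representation B ?w b else 0)"
      unfolding inner_sum_right using B b
      by (intro sum.cong) (auto simp: pairwise_def orthogonal_def norm_eq_1)
    finally show "representation B ?w b = b \<bullet> ?w"
      using fin b by simp
  qed
  also have "\<dots> = (\<Sum>b\<in>B. - (b \<bullet> H b) / norm (G p))"
  proof (intro sum.cong refl)
    fix b assume "b \<in> B"
    then have "G p \<bullet> b = 0"
      using B(3) span_base by blast
    then show "b \<bullet> - N' b = - (b \<bullet> H b) / norm (G p)"
      by (simp add: N'_def inner_diff_right inner_commute field_simps)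
  qed
  finally show ?thesis
    by (simp add: mean_curvature_def grad sum_negf flip: sum_divide_distrib)
qed

section \<open>Comparison with a touching ball\<close>

lemma second_derivative_nonpos_at_max:
  fixes f f' :: "real \<Rightarrow> real"
  assumes f: "\<And>s. (f has_real_derivative f' s) (at s)" and f': "(f' has_real_derivative D) (at a)"
    and max: "\<And>s. f s \<le> f a"
  shows "D \<le> 0"
proof (rule ccontr)
  assume "\<not> D \<le> 0"
  moreover have "f' a = 0"
    using DERIV_local_max[OF f zero_less_one] max by blast
  ultimately obtain e where e: "e > 0" "\<And>h. 0 < h \<Longrightarrow> h < e \<Longrightarrow> f' (a + h) > 0"
    using DERIV_pos_inc_right[OF f'] by auto
  define h where "h = e / 2"
  have h: "0 < h" "h < e"
    using \<open>e > 0\<close> by (auto simp: h_def)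
  obtain z where z: "a < z" "z < a + h" "f (a + h) - f a = (a + h - a) * f' z"
    using MVT2[of a "a + h" f f'] f h(1) by auto
  have "h * f' z > 0"
    using e(2)[of "z - a"] z(1,2) h by simp
  with z(3) max[of "a + h"] show False by simp
qed

text \<open>At the contact point \<open>G p\<close> is an outward normal of the sphere. The second
  derivative of \<open>f\<close> along the great circle in direction \<open>v\<close> is therefore
  \<open>d * d * (v \<bullet> H v) - d * norm (G p)\<close>, and it is at most 0 at a
  maximum.\<close>

lemma ball_touching_gradient_hessian:
  fixes f :: "'a::euclidean_space \<Rightarrow> real"
  assumes G: "\<And>x. GDERIV f x :> G x" and H: "(G has_derivative H) (at p)"
    and le: "\<And>x. dist c x \<le> d \<Longrightarrow> f x \<le> 0" and p: "f p = 0" "dist c p = d" and "d > 0"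
    and v: "G p \<bullet> v = 0" "norm v = 1" and nz: "G p \<noteq> 0"
  shows "v \<bullet> H v \<le> norm (G p) / d"
proof -
  define u where "u = (p - c) /\<^sub>R d"
  have nu: "norm u = 1"
    using p \<open>d > 0\<close> by (simp add: u_def dist_norm norm_minus_commute)
  have pu: "p = c + d *\<^sub>R u"
    using \<open>d > 0\<close> by (simp add: u_def)
  \<comment> \<open>Great circles through \<open>p\<close>: along each of them \<open>f\<close> has a maximum at \<open>s = 0\<close>.\<close>
  define \<gamma> where "\<gamma> w s = c + d *\<^sub>R (cos s *\<^sub>R u + sin s *\<^sub>R w)" for w s
  define \<gamma>' where "\<gamma>' w s = d *\<^sub>R (cos s *\<^sub>R w - sin s *\<^sub>R u)" for w s
  have \<gamma>0: "\<gamma> w 0 = p" for w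
    by (simp add: \<gamma>_def pu)
  have \<gamma>D: "(\<gamma> w has_derivative (\<lambda>h. h *\<^sub>R \<gamma>' w s)) (at s)" for w s
    unfolding \<gamma>_def \<gamma>'_def
    by (auto intro!: derivative_eq_intros simp: fun_eq_iff algebra_simps)
  have \<gamma>'D: "(\<gamma>' w has_derivative (\<lambda>h. h *\<^sub>R - (d *\<^sub>R u))) (at 0)" for w
    unfolding \<gamma>'_def
    by (auto intro!: derivative_eq_intros simp: fun_eq_iff algebra_simps)
  have \<phi>D: "((\<lambda>s. f (\<gamma> w s)) has_real_derivative \<gamma>' w s \<bullet> G (\<gamma> w s)) (at s)" for w s
    using has_derivative_compose[OF \<gamma>D G[unfolded gderiv_def], of w s]
    by (simp add: has_field_derivative_def mult.commute[of _ "_ \<bullet> _"])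
  have max: "f (\<gamma> w s) \<le> f (\<gamma> w 0)" if "u \<bullet> w = 0" "norm w = 1" for w s
  proof -
    have "(norm (cos s *\<^sub>R u + sin s *\<^sub>R w))\<^sup>2 = (norm (cos s *\<^sub>R u))\<^sup>2 + (norm (sin s *\<^sub>R w))\<^sup>2"
      using that by (intro norm_add_Pythagorean) (simp add: orthogonal_def)
    also have "\<dots> = 1\<^sup>2"
      using that nu by simp
    finally have "norm (cos s *\<^sub>R u + sin s *\<^sub>R w) = 1"
      by (rule power2_eq_imp_eq) auto
    then have "dist c (\<gamma> w s) = d"
      using \<open>d > 0\<close> by (simp add: \<gamma>_def dist_norm)
    then show ?thesis
      using le p by (simp add: \<gamma>0)
  qed
  have crit: "G p \<bullet> w = 0" if "u \<bullet> w = 0" "norm w = 1" for w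
  proof -
    have "\<gamma>' w 0 \<bullet> G (\<gamma> w 0) = 0"
      using DERIV_local_max[OF \<phi>D zero_less_one] max[OF that] by blast
    then show ?thesis
      using \<open>d > 0\<close> by (simp add: \<gamma>0 \<gamma>'_def inner_commute)
  qed
  \<comment> \<open>The component \<open>w\<close> of \<open>G p\<close> tangent to the sphere
    vanishes, since \<open>p\<close> is critical along the great circle in direction
    \<open>sgn w\<close>.\<close>
  have Gu: "G p = (G p \<bullet> u) *\<^sub>R u"
  proof (rule ccontr)
    define w where "w = G p - (G p \<bullet> u) *\<^sub>R u"
    assume "\<not> ?thesis"
    then have "w \<noteq> 0" by (simp add: w_def)
    have "u \<bullet> w = 0"
      using nu by (simp add: w_def inner_diff_right inner_commute norm_eq_1)
    then have "G p \<bullet> sgn w = 0"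
      using crit[of "sgn w"] \<open>w \<noteq> 0\<close> by (simp add: sgn_div_norm)
    then have "G p \<bullet> w = 0"
      using \<open>w \<noteq> 0\<close> by (simp add: sgn_div_norm)
    then have "w \<bullet> w = 0"
      using \<open>u \<bullet> w = 0\<close> unfolding w_def by (simp add: inner_diff_left)
    with \<open>w \<noteq> 0\<close> show False by simp
  qed
  \<comment> \<open>Otherwise \<open>f\<close> would be positive on the radius just inside
    \<open>p\<close>.\<close>
  have "0 \<le> G p \<bullet> u"
  proof (rule ccontr)
    assume neg: "\<not> 0 \<le> G p \<bullet> u"
    have "((\<lambda>s. c + s *\<^sub>R u) has_derivative (\<lambda>h. h *\<^sub>R u)) (at d)"
      by (auto intro!: derivative_eq_intros)
    from has_derivative_compose[OF this G[unfolded gderiv_def]]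
    have "((\<lambda>s. f (c + s *\<^sub>R u)) has_real_derivative G p \<bullet> u) (at d)"
      by (simp add: has_field_derivative_def pu inner_commute mult.commute[of _ "_ \<bullet> _"])
    from DERIV_neg_dec_left[OF this] neg obtain e
      where e: "e > 0" "\<And>h. 0 < h \<Longrightarrow> h < e \<Longrightarrow> f (c + d *\<^sub>R u) < f (c + (d - h) *\<^sub>R u)"
      by auto
    \<comment> \<open>The bound by \<open>d\<close> keeps the point
      \<open>c + (d - h) *\<^sub>R u\<close> in the ball.\<close>
    define h where "h = min (e / 2) d"
    have h: "0 < h" "h < e" "h \<le> d"
      using e \<open>d > 0\<close> by (auto simp: h_def)
    then have "f (c + (d - h) *\<^sub>R u) \<le> 0"
      using nu by (intro le) (simp add: dist_norm)
    with e(2)[OF h(1,2)] p pu show False by simp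
  qed
  moreover have "norm (G p) = \<bar>G p \<bullet> u\<bar>"
    by (subst Gu) (simp add: nu)
  ultimately have normG: "G p \<bullet> u = norm (G p)" by simp
  have uv: "u \<bullet> v = 0"
    using v(1) nz by (subst (asm) Gu) (auto simp: normG)
  \<comment> \<open>The first summand is the Hessian term; the second comes from the acceleration
    \<open>- (d *\<^sub>R u)\<close> of the circle at \<open>p\<close>.\<close>
  have D: "((\<lambda>s. \<gamma>' v s \<bullet> G (\<gamma> v s)) has_derivative
      (\<lambda>h. \<gamma>' v 0 \<bullet> H (h *\<^sub>R \<gamma>' v 0) + h *\<^sub>R - (d *\<^sub>R u) \<bullet> G (\<gamma> v 0))) (at 0)"
    using H by (intro has_derivative_inner \<gamma>'D has_derivative_compose[OF \<gamma>D]) (simp add: \<gamma>0)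
  have eq: "\<gamma>' v 0 \<bullet> H (h *\<^sub>R \<gamma>' v 0) + h *\<^sub>R - (d *\<^sub>R u) \<bullet> G (\<gamma> v 0)
      = (d * (d * (v \<bullet> H v)) - d * (G p \<bullet> u)) * h" for h
    by (simp add: \<gamma>0 \<gamma>'_def linear_scale[OF has_derivative_linear[OF H]]
        inner_commute[of u] algebra_simps)
  have "((\<lambda>s. \<gamma>' v s \<bullet> G (\<gamma> v s)) has_real_derivative
      d * (d * (v \<bullet> H v)) - d * (G p \<bullet> u)) (at 0)"
    unfolding has_field_derivative_def by (rule has_derivative_eq_rhs[OF D], rule ext, rule eq)
  from second_derivative_nonpos_at_max[OF \<phi>D this max[OF uv v(2)]]
  have "d * (d * (v \<bullet> H v)) \<le> d * norm (G p)"
    by (simp add: normG)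
  then show ?thesis
    using \<open>d > 0\<close> by (simp add: field_simps)
qed

section \<open>Polynomials of odd degree\<close>

text \<open>Serves to show that the leading form, known to have a non-zero coefficient, is not the
  zero function.\<close>

lemma distinct_monomials_independent:
  fixes c :: "('d::finite \<Rightarrow>\<^sub>0 nat) \<Rightarrow> real"
  assumes "finite S"
    and "\<And>x :: real ^ 'd. (\<Sum>\<alpha>\<in>S. c \<alpha> * (\<Prod>i\<in>UNIV. (x $ i) ^ Poly_Mapping.lookup \<alpha> i)) = 0"
    and "\<beta> \<in> S"
  shows "c \<beta> = 0"
  using assms
proof (induction S arbitrary: c \<beta> rule: finite_induct)
  case empty
  then show ?case by simp
next
  case (insert \<gamma> S)
  let ?mon = "\<lambda>\<alpha> (x :: real ^ 'd). \<Prod>i\<in>UNIV. (x $ i) ^ Poly_Mapping.lookup \<alpha> i"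
  have S: "c \<alpha> = 0" if "\<alpha> \<in> S" for \<alpha>
  proof -
    have "\<alpha> \<noteq> \<gamma>" using that insert.hyps by blast
    then obtain j where j: "Poly_Mapping.lookup \<alpha> j \<noteq> Poly_Mapping.lookup \<gamma> j"
      by (auto simp: poly_mapping_eq_iff fun_eq_iff)
    \<comment> \<open>Doubling the \<open>j\<close>-th coordinate multiplies each monomial by its own factor \<open>q\<close>; subtracting
      \<open>q \<gamma>\<close> times the original relation eliminates \<open>\<gamma>\<close>, but not \<open>\<alpha>\<close>.\<close>
    define q where "q \<delta> = (2::real) ^ Poly_Mapping.lookup \<delta> j" for \<delta> :: "'d \<Rightarrow>\<^sub>0 nat"
    have "(\<Sum>\<delta>\<in>S. ((q \<delta> - q \<gamma>) * c \<delta>) * ?mon \<delta> x) = 0" for x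
    proof -
      define y :: "real ^ 'd" where "y = (\<chi> i. (if i = j then 2 else 1) * x $ i)"
      have "?mon \<delta> y = q \<delta> * ?mon \<delta> x" for \<delta>
      proof -
        have "?mon \<delta> y = (\<Prod>i\<in>UNIV. (if i = j then q \<delta> else 1) * (x $ i) ^ Poly_Mapping.lookup \<delta> i)"
          by (intro prod.cong) (auto simp: y_def q_def power_mult_distrib)
        then show ?thesis by (simp add: prod.distrib)
      qed
      then have "(\<Sum>\<delta>\<in>insert \<gamma> S. ((q \<delta> - q \<gamma>) * c \<delta>) * ?mon \<delta> x)
          = (\<Sum>\<delta>\<in>insert \<gamma> S. c \<delta> * ?mon \<delta> y) - q \<gamma> * (\<Sum>\<delta>\<in>insert \<gamma> S. c \<delta> * ?mon \<delta> x)"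
        unfolding sum_distrib_left sum_subtractf[symmetric]
        by (intro sum.cong) (auto simp: algebra_simps)
      also have "\<dots> = 0"
        by (simp only: insert.prems(1) mult_zero_right diff_self)
      finally show ?thesis
        using insert.hyps by simp
    qed
    from insert.IH[OF this that] show ?thesis
      using j by (simp add: q_def)
  qed
  \<comment> \<open>At the all-ones vector every monomial is 1, so the relation reduces to
    \<open>c \<gamma> = 0\<close>.\<close>
  then have "c \<gamma> = 0"
    using insert.prems(1)[of "\<chi> i. 1"] insert.hyps by simp
  with S insert.prems(2) show ?case by blast
qed

lemma real_polynomial_function_mpoly_fun: "real_polynomial_function (mpoly_fun P)"
proof -
  have "real_polynomial_function (\<lambda>x :: real ^ 'd. x $ i)" for i :: "'d::finite"
    by (intro real_polynomial_function.intros(1) bounded_linear_vec_nth)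
  then show ?thesis
    unfolding mpoly_fun_def[abs_def] by (auto intro!: real_polynomial_function_sum
      real_polynomial_function.intros(2,4) real_polynomial_function_prod real_polynomial_function_power)
qed

lemma odd_degree_large_balls:
  fixes P :: "'d::finite real_mpoly"
  assumes "odd (total_degree P)" and "R > 0"
  obtains a b where "\<And>x. dist a x < R \<Longrightarrow> mpoly_fun P x < 0" "\<And>x. dist b x < R \<Longrightarrow> mpoly_fun P x > 0"
proof -
  define m where "m = total_degree P"
  let ?deg = "\<lambda>\<alpha> :: 'd \<Rightarrow>\<^sub>0 nat. \<Sum>i\<in>UNIV. Poly_Mapping.lookup \<alpha> i"
  let ?mon = "\<lambda>\<alpha> (x :: real ^ 'd). \<Prod>i\<in>UNIV. (x $ i) ^ Poly_Mapping.lookup \<alpha> i"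
  have deg_le: "?deg \<alpha> \<le> m" if "\<alpha> \<in> Poly_Mapping.keys P" for \<alpha>
    unfolding m_def total_degree_def using that by (intro Max_ge) auto
  have "m \<in> insert 0 (?deg ` Poly_Mapping.keys P)"
    unfolding m_def total_degree_def by (intro Max_in) auto
  moreover have "odd m" using assms m_def by simp
  \<comment> \<open>Oddness excludes the default value 0 in \<open>total_degree\<close>, so the
    degree is attained by a monomial of \<open>P\<close>.\<close>
  ultimately obtain \<beta> where \<beta>: "\<beta> \<in> Poly_Mapping.keys P" "?deg \<beta> = m"
    by (cases "m = 0") auto
  \<comment> \<open>\<open>Q s\<close> is the homogenization of \<open>P\<close>; in particular \<open>Q 0\<close> is its leading form. Balls of radius
    \<open>R\<close> far out correspond to small neighbourhoods of a point at \<open>s = 0\<close>, and as \<open>m\<close> is odd, the two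
    signs of \<open>s\<close> yield the two signs of \<open>P\<close>.\<close>
  define Q where "Q s x = (\<Sum>\<alpha>\<in>Poly_Mapping.keys P. Poly_Mapping.lookup P \<alpha> * s ^ (m - ?deg \<alpha>) * ?mon \<alpha> x)"
    for s :: real and x
  have Q: "Q s (s *\<^sub>R x) = s ^ m * mpoly_fun P x" for s x
    unfolding Q_def mpoly_fun_def sum_distrib_left
  proof (intro sum.cong refl)
    fix \<alpha> assume \<alpha>: "\<alpha> \<in> Poly_Mapping.keys P"
    have mon: "?mon \<alpha> (s *\<^sub>R x) = s ^ ?deg \<alpha> * ?mon \<alpha> x"
      by (simp add: power_mult_distrib prod.distrib power_sum)
    have pow: "s ^ m = s ^ (m - ?deg \<alpha>) * s ^ ?deg \<alpha>"
      using deg_le[OF \<alpha>] by (simp flip: power_add)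
    show "Poly_Mapping.lookup P \<alpha> * s ^ (m - ?deg \<alpha>) * ?mon \<alpha> (s *\<^sub>R x)
        = s ^ m * (Poly_Mapping.lookup P \<alpha> * ?mon \<alpha> x)"
      unfolding mon pow by (simp only: mult_ac)
  qed
  obtain v0 where v0: "Q 0 v0 \<noteq> 0"
  proof -
    have "\<exists>x. Q 0 x \<noteq> 0"
    proof (rule ccontr)
      assume "\<not> ?thesis"
      then have "(\<Sum>\<alpha>\<in>Poly_Mapping.keys P. Poly_Mapping.lookup P \<alpha> * 0 ^ (m - ?deg \<alpha>) * ?mon \<alpha> x) = 0" for x
        unfolding Q_def by blast
      from distinct_monomials_independent[OF finite_keys this \<beta>(1)]
      have "Poly_Mapping.lookup P \<beta> * 0 ^ (m - ?deg \<beta>) = 0" .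
      with \<beta> show False by (simp add: in_keys_iff)
    qed
    with that show thesis by blast
  qed
  \<comment> \<open>The factor \<open>0 ^ (m - ?deg \<alpha>)\<close> is 1 for monomials of degree
    \<open>m\<close> and 0 for all others, so only odd monomials survive.\<close>
  have Q0: "Q 0 (- x) = - Q 0 x" for x
  proof -
    have mon: "?mon \<alpha> (- x) = (-1) ^ ?deg \<alpha> * ?mon \<alpha> x" for \<alpha>
      unfolding power_sum prod.distrib[symmetric] power_mult_distrib[symmetric] by simp
    have "0 ^ (m - ?deg \<alpha>) * ?mon \<alpha> (- x) = - (0 ^ (m - ?deg \<alpha>) * ?mon \<alpha> x)"
      if "\<alpha> \<in> Poly_Mapping.keys P" for \<alpha>
    proof (cases "?deg \<alpha> = m")
      case True
      then show ?thesis using \<open>odd m\<close> unfolding mon by simp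
    next
      case False
      then have "m - ?deg \<alpha> > 0" using deg_le[OF that] by simp
      then show ?thesis by (simp only: power_0_left) simp
    qed
    then show ?thesis
      unfolding Q_def sum_negf[symmetric] by (intro sum.cong) (auto simp: mult.assoc)
  qed
  obtain v where v: "Q 0 v < 0"
    using v0 Q0[of v0] by (cases "Q 0 v0 < 0") (auto intro: that[of "- v0"])
  have "continuous_on UNIV (\<lambda>z. Q (fst z) (snd z))"
    unfolding Q_def by (intro continuous_intros)
  then have op: "open {z. Q (fst z) (snd z) < 0}"
    by (intro open_Collect_less continuous_intros)
  then obtain e where "e > 0" and ball: "ball (0, v) e \<subseteq> {z. Q (fst z) (snd z) < 0}"
    using openE[OF op, of "(0, v)"] v by auto
  have e: "Q t y < 0" if "dist (0, v) (t, y) < e" for t y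
    using ball that by (auto simp: subset_iff)
  \<comment> \<open>If \<open>\<bar>t\<bar> = s\<close> and \<open>x\<close> is within
    \<open>R\<close> of \<open>v /\<^sub>R t\<close>, then \<open>(t, t *\<^sub>R x)\<close> is
    within \<open>s + s * R\<close> of \<open>(0, v)\<close>; this has to stay below
    \<open>e\<close>.\<close>
  define s where "s = e / (2 * (1 + R))"
  have s: "s > 0" "s * (1 + R) < e"
  proof -
    have "s * (1 + R) = e / 2"
      using \<open>R > 0\<close> by (simp add: s_def field_simps)
    then show "s * (1 + R) < e"
      using \<open>e > 0\<close> by linarith
    show "s > 0"
      using \<open>e > 0\<close> \<open>R > 0\<close> by (simp add: s_def)
  qed
  have neg: "t ^ m * mpoly_fun P x < 0" if "\<bar>t\<bar> = s" "dist (v /\<^sub>R t) x < R" for t x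
  proof -
    have "t \<noteq> 0" using that s by auto
    have "dist v (t *\<^sub>R x) = dist (t *\<^sub>R (v /\<^sub>R t)) (t *\<^sub>R x)"
      using \<open>t \<noteq> 0\<close> by simp
    also have "\<dots> = s * dist (v /\<^sub>R t) x"
      unfolding dist_norm scaleR_diff_right[symmetric] norm_scaleR using that by simp
    also have "\<dots> < s * R"
      using that s by simp
    finally have "dist v (t *\<^sub>R x) < s * R" .
    moreover have "dist (0, v) (t, t *\<^sub>R x) \<le> dist 0 t + dist v (t *\<^sub>R x)"
      unfolding dist_Pair_Pair by (rule sqrt_sum_squares_le_sum) auto
    ultimately have "dist (0, v) (t, t *\<^sub>R x) < e"
      using s that by (simp add: dist_norm algebra_simps)
    from e[OF this] show ?thesis by (simp add: Q)
  qed
  show thesis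
  proof
    show "mpoly_fun P x < 0" if "dist (v /\<^sub>R s) x < R" for x
      using neg[OF _ that] s by (simp add: mult_less_0_iff zero_less_power not_less)
    show "mpoly_fun P x > 0" if "dist (v /\<^sub>R (- s)) x < R" for x
      using neg[OF _ that] s \<open>odd m\<close> by (simp add: zero_less_mult_iff)
  qed
qed

section \<open>Curvature bounds and the contradiction\<close>

text \<open>The point \<open>p\<close> is a zero nearest to \<open>a\<close>. The ball about
  \<open>a\<close> through \<open>p\<close> has radius \<open>d \<ge> R\<close> and touches the
  hypersurface from the side \<open>f \<le> 0\<close>, so each diagonal Hessian entry is at most
  \<open>norm (G p) / d\<close>. The point \<open>b\<close> guarantees that there is a zero at
  all.\<close>

proposition mean_curvature_lower_bound:
  fixes f :: "'a::euclidean_space \<Rightarrow> real"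
  assumes f: "real_polynomial_function f" and reg: "regular_hypersurface f"
    and dim: "DIM('a) \<ge> 2" and "R > 0"
    and neg: "\<And>x. dist a x < R \<Longrightarrow> f x < 0" and "f b \<ge> 0"
  obtains p where "p \<in> zero_set f" "mean_curvature f p \<ge> - (1 / R)"
proof -
  obtain G where pG: "polynomial_function G" and G: "\<And>x. GDERIV f x :> G x"
    using real_polynomial_function_gradient[OF f] by blast
  have cont: "continuous_on S f" for S
    using f by (simp add: continuous_on_polymonial_function real_polynomial_function_eq)
  have "f a < 0"
    using neg[of a] \<open>R > 0\<close> by simp
  have crossing: "\<exists>z\<in>closed_segment a x. f z = 0" if "f x \<ge> 0" for x
  proof -
    have conn: "connected (f ` closed_segment a x)"
      by (intro connected_continuous_image cont connected_segment)
    have "0 \<in> f ` closed_segment a x"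
      by (rule connectedD_interval[OF conn, of "f a" "f x"]) (use \<open>f a < 0\<close> that in auto)
    then show ?thesis by force
  qed
  have "closed (zero_set f)"
    unfolding zero_set_def by (intro closed_Collect_eq cont continuous_on_const)
  moreover have "zero_set f \<noteq> {}"
    using crossing[OF \<open>f b \<ge> 0\<close>] by (auto simp: zero_set_def)
  ultimately obtain p where p: "p \<in> zero_set f" "\<And>y. y \<in> zero_set f \<Longrightarrow> dist a p \<le> dist a y"
    using distance_attains_inf by metis
  define d where "d = dist a p"
  have "R \<le> d"
    using neg[of p] p(1) by (force simp: d_def zero_set_def not_le)
  \<comment> \<open>A point of the closed ball with \<open>f > 0\<close> would have a zero on its
    segment from \<open>a\<close>, strictly closer to \<open>a\<close> than
    \<open>p\<close>.\<close>
  have le: "f x \<le> 0" if "dist a x \<le> d" for x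
  proof (rule ccontr)
    assume "\<not> f x \<le> 0"
    then obtain z where z: "z \<in> closed_segment a x" "f z = 0"
      using crossing[of x] by auto
    have "dist a x = dist a z + dist z x"
      using z(1) by (simp flip: between_mem_segment add: between)
    moreover have "0 < dist z x"
      using z \<open>\<not> f x \<le> 0\<close> by auto
    moreover have "d \<le> dist a z"
      using p(2)[of z] z(2) by (simp add: d_def zero_set_def)
    ultimately show False
      using that by linarith
  qed
  obtain H where H: "(G has_derivative H) (at p)"
    using differentiable_at_polynomial_function[OF pG] by (auto simp: differentiable_def)
  have nz: "G p \<noteq> 0"
    using reg p(1) gradient_eqI[OF G] by (auto simp: regular_hypersurface_def)
  have "subspace {v. G p \<bullet> v = 0}"
    by (rule subspace_hyperplane)
  then obtain B where B: "pairwise orthogonal B" "\<And>b. b \<in> B \<Longrightarrow> norm b = 1"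
      "card B = dim {v. G p \<bullet> v = 0}" "span B = {v. G p \<bullet> v = 0}"
    using orthonormal_basis_subspace by metis
  have "(\<Sum>b\<in>B. b \<bullet> H b) \<le> (\<Sum>b\<in>B. norm (G p) / d)"
  proof (intro sum_mono)
    fix b assume "b \<in> B"
    then have "G p \<bullet> b = 0"
      using B(4) span_base by blast
    with \<open>b \<in> B\<close> show "b \<bullet> H b \<le> norm (G p) / d"
      using le p(1) \<open>R \<le> d\<close> \<open>R > 0\<close> B(2) nz
      by (intro ball_touching_gradient_hessian[OF G H, of a d])
        (auto simp: d_def zero_set_def)
  qed
  also have "\<dots> = real (DIM('a) - 1) * norm (G p) * (1 / d)"
    using B(3) dim_hyperplane[OF nz] by simp
  also have "\<dots> \<le> real (DIM('a) - 1) * norm (G p) * (1 / R)"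
    using \<open>R \<le> d\<close> \<open>R > 0\<close> by (intro mult_left_mono divide_left_mono) auto
  finally have "(\<Sum>b\<in>B. b \<bullet> H b) / (real (DIM('a) - 1) * norm (G p)) \<le> 1 / R"
    using dim nz by (subst pos_divide_le_eq) (auto simp: mult_ac)
  then have "mean_curvature f p \<ge> - (1 / R)"
    using mean_curvature_orthonormal_basis[OF G H nz B(1,2,4)] by simp
  with p(1) that show thesis by blast
qed

lemma gradient_uminus:
  fixes f :: "'a::euclidean_space \<Rightarrow> real"
  assumes "real_polynomial_function f"
  shows "gradient (\<lambda>x. - f x) x = - gradient f x"
  by (metis assms real_polynomial_function_gradient gradient_eqI GDERIV_minus)

text \<open>\<open>G\<close> and \<open>H\<close> change sign but \<open>norm (G p)\<close> does
  not. This turns the lower bound for \<open>- f\<close> into an upper bound for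
  \<open>f\<close>.\<close>

lemma mean_curvature_uminus:
  fixes f :: "'a::euclidean_space \<Rightarrow> real"
  assumes f: "real_polynomial_function f" and nz: "gradient f p \<noteq> 0"
  shows "mean_curvature (\<lambda>x. - f x) p = - mean_curvature f p"
proof -
  obtain G where pG: "polynomial_function G" and G: "\<And>x. GDERIV f x :> G x"
    using real_polynomial_function_gradient[OF f] by blast
  obtain H where H: "(G has_derivative H) (at p)"
    using differentiable_at_polynomial_function[OF pG] by (auto simp: differentiable_def)
  have nz': "G p \<noteq> 0"
    using nz gradient_eqI[OF G] by simp
  obtain B where B: "pairwise orthogonal B" "\<And>b. b \<in> B \<Longrightarrow> norm b = 1" "span B = {v. G p \<bullet> v = 0}"
    using orthonormal_basis_subspace[OF subspace_hyperplane] by metis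
  have "mean_curvature (\<lambda>x. - f x) p
      = - (\<Sum>b\<in>B. b \<bullet> - H b) / (real (DIM('a) - 1) * norm (- G p))"
    using B nz' by (intro mean_curvature_orthonormal_basis GDERIV_minus G has_derivative_minus H) auto
  then show ?thesis
    using mean_curvature_orthonormal_basis[OF G H nz' B] by (simp add: sum_negf)
qed

theorem theorem1p1:
  fixes n m :: nat and P :: "'d::finite real_mpoly"
  assumes "n \<ge> 2" and "CARD('d) = n + 1"
    and "total_degree P = m"
    and "regular_hypersurface (mpoly_fun P)"
    and "nonzero_constant_mean_curvature (mpoly_fun P)"
  shows "even m"
proof (rule ccontr)
  assume "odd m"
  let ?f = "mpoly_fun P"
  note poly = real_polynomial_function_mpoly_fun[of P]
  have dim: "DIM(real ^ 'd) \<ge> 2"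
    using assms(1,2) by simp
  obtain c where c: "c \<noteq> 0" "\<And>p. p \<in> zero_set ?f \<Longrightarrow> mean_curvature ?f p = c"
    using assms(5) by (auto simp: nonzero_constant_mean_curvature_def)
  have zero_set: "zero_set (\<lambda>x. - ?f x) = zero_set ?f"
    by (simp add: zero_set_def)
  have reg: "regular_hypersurface (\<lambda>x. - ?f x)"
    using assms(4) by (simp add: regular_hypersurface_def zero_set gradient_uminus[OF poly])
  \<comment> \<open>Any radius above \<open>1 / \<bar>c\<bar>\<close> works: the two bounds give
    \<open>\<bar>c\<bar> \<le> 1 / R\<close>, here \<open>\<bar>c\<bar> / 2\<close>.\<close>
  define R where "R = 2 / \<bar>c\<bar>"
  have R: "R > 0" "1 / R < \<bar>c\<bar>"
    using c(1) by (auto simp: R_def)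
  obtain a b where a: "\<And>x. dist a x < R \<Longrightarrow> ?f x < 0" and b: "\<And>x. dist b x < R \<Longrightarrow> ?f x > 0"
    using odd_degree_large_balls[of P R] \<open>odd m\<close> assms(3) R(1) by blast
  have ab: "?f a < 0" "?f b > 0"
    using a[of a] b[of b] R(1) by auto
  obtain p where "p \<in> zero_set ?f" "mean_curvature ?f p \<ge> - (1 / R)"
    using mean_curvature_lower_bound[OF poly assms(4) dim R(1), of a b] a ab by auto
  then have "c \<ge> - (1 / R)"
    using c(2) by auto
  \<comment> \<open>For \<open>- ?f\<close> the roles of \<open>a\<close> and \<open>b\<close> are
    exchanged.\<close>
  moreover obtain q where q: "q \<in> zero_set ?f" "mean_curvature (\<lambda>x. - ?f x) q \<ge> - (1 / R)"
    using mean_curvature_lower_bound[OF real_polynomial_function_minus[OF poly] reg dim R(1), of b a]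
      ab b by (auto simp: zero_set)
  moreover have "mean_curvature (\<lambda>x. - ?f x) q = - c"
    using mean_curvature_uminus[OF poly] q(1) assms(4) c(2) by (simp add: regular_hypersurface_def)
  ultimately show False
    using R(2) by linarith
qed

end
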